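(* There is an absolute constant $C>0$ such that for every integer $n \ge 1$, $$D(n) \ge \frac{n}{2} + \frac{n}{236} - C\sqrt{n}.$$
   Context: Let $P$ be a finite set of points in the plane. A disk (of positive radius) is empty (with respect to $P$) if its interior contains no point of $P$. Disks are called pairwise-disjoint if their interiors are pairwise disjoint (so two disks may touch at a common boundary point). $D(P)$ is the minimum number of disks in a family of pairwise-disjoint empty disks such that each point of $P$ lies on the boundary of at least one disk of the family. $D(n)$ is the maximum of $D(P)$ over all sets $P$ of $n$ points in the plane. *)

theory Defs
  imports "HOL-Analysis.Analysis"
begin

definition is_disk :: "(real^2) set \<Rightarrow> bool" where
  "is_disk K \<longleftrightarrow> (\<exists>c r. r > 0 \<and> K = cball c r)"

definition empty_disk :: "(real^2) set \<Rightarrow> (real^2) set \<Rightarrow> bool" where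
  "empty_disk P K \<longleftrightarrow> is_disk K \<and> interior K \<inter> P = {}"

text \<open>A family of disks is a set of disks: repetitions cannot occur in a
  family of disks with pairwise disjoint interiors, since the radii are positive.\<close>

definition disk_cover :: "(real^2) set \<Rightarrow> (real^2) set set \<Rightarrow> bool" where
  "disk_cover P F \<longleftrightarrow>
     finite F \<and>
     (\<forall>K\<in>F. empty_disk P K) \<and>
     pairwise (\<lambda>K L. interior K \<inter> interior L = {}) F \<and>
     (\<forall>p\<in>P. \<exists>K\<in>F. p \<in> frontier K)"

definition min_disks :: "(real^2) set \<Rightarrow> nat" where
  "min_disks P = (LEAST k. \<exists>F. disk_cover P F \<and> card F = k)"

definition max_min_disks :: "nat \<Rightarrow> nat" where
  "max_min_disks n = Max {min_disks P | P. finite P \<and> card P = n}"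

text \<open>The minimum and the maximum above are attained: attaching a small disk to
  each point gives a valid family, so the value for an \<open>n\<close>-point set is at
  most \<open>n\<close>.\<close>

lemma disk_cover_exists:
  assumes "finite P"
  shows "\<exists>F. disk_cover P F \<and> card F \<le> card P"
proof -
  define e :: "real^2" where "e = axis 1 1"
  have ne: "norm e = 1" by (simp add: e_def)
  have "\<exists>d>0. \<forall>p\<in>P. \<forall>q\<in>P. p \<noteq> q \<longrightarrow> d \<le> dist p q"
  proof -
    define S where "S = insert 1 ((\<lambda>(p,q). dist p q) ` {(p,q). p \<in> P \<and> q \<in> P \<and> p \<noteq> q})"
    have "{(p,q). p \<in> P \<and> q \<in> P \<and> p \<noteq> q} \<subseteq> P \<times> P" by auto
    then have fin: "finite S"
      unfolding S_def using assms finite_subset by blast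
    have "\<forall>x\<in>S. x > 0" by (auto simp: S_def)
    moreover have "S \<noteq> {}" by (simp add: S_def)
    ultimately have "Min S > 0" using fin by simp
    moreover have "Min S \<le> dist p q" if "p \<in> P" "q \<in> P" "p \<noteq> q" for p q
      using fin that by (intro Min_le) (auto simp: S_def)
    ultimately show ?thesis by blast
  qed
  then obtain d where d: "d > 0" "\<And>p q. p \<in> P \<Longrightarrow> q \<in> P \<Longrightarrow> p \<noteq> q \<Longrightarrow> d \<le> dist p q"
    by blast
  define K where "K p = cball (p + (d/4) *\<^sub>R e) (d/4)" for p
  have intK: "interior (K p) = ball (p + (d/4) *\<^sub>R e) (d/4)" for p
    by (simp add: K_def interior_cball)
  have dK: "dist (p + (d/4) *\<^sub>R e) p = d/4" for p
    using d(1) by (simp add: dist_norm ne)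
  have 1: "empty_disk P (K p)" if p: "p \<in> P" for p
  proof -
    have "q \<notin> ball (p + (d/4) *\<^sub>R e) (d/4)" if q: "q \<in> P" for q
    proof (cases "p = q")
      case True
      then show ?thesis using dK[of p] by simp
    next
      case False
      have "dist p q \<le> dist p (p + (d/4) *\<^sub>R e) + dist (p + (d/4) *\<^sub>R e) q"
        by (rule dist_triangle)
      then show ?thesis
        using dK[of p] d(2)[OF p q False] d(1) by (simp add: dist_commute)
    qed
    then have "interior (K p) \<inter> P = {}"
      unfolding intK by blast
    moreover have "is_disk (K p)"
      unfolding is_disk_def K_def using d(1) by (intro exI[of _ "p + (d/4) *\<^sub>R e"] exI[of _ "d/4"]) simp
    ultimately show ?thesis
      unfolding empty_disk_def by blast
  qed
  have 2: "interior (K p) \<inter> interior (K q) = {}" if "p \<in> P" "q \<in> P" "K p \<noteq> K q" for p q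
  proof -
    have "d \<le> dist p q" using that d(2) by blast
    then have "d/4 + d/4 \<le> dist (p + (d/4) *\<^sub>R e) (q + (d/4) *\<^sub>R e)"
      using d(1) by simp
    then show ?thesis unfolding intK by (rule disjoint_ballI)
  qed
  have 3: "p \<in> frontier (K p)" for p
    using d(1) dK[of p] by (simp add: K_def)
  have "disk_cover P (K ` P)"
    unfolding disk_cover_def pairwise_def using assms 1 2 3 by blast
  then show ?thesis using card_image_le[OF assms] by blast
qed

lemma min_disks_attained:
  assumes "finite P"
  shows "\<exists>F. disk_cover P F \<and> card F = min_disks P"
  unfolding min_disks_def
  by (rule LeastI_ex) (use disk_cover_exists[OF assms] in blast)

lemma min_disks_le: "disk_cover P F \<Longrightarrow> min_disks P \<le> card F"
  unfolding min_disks_def by (rule Least_le) blast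

lemma finite_min_disks: "finite {min_disks P | P. finite P \<and> card P = n}"
proof (rule finite_subset)
  show "{min_disks P | P. finite P \<and> card P = n} \<subseteq> {..n}"
    using disk_cover_exists min_disks_le order_trans by fastforce
qed simp

lemma min_disks_nonempty: "{min_disks P | P. finite P \<and> card P = n} \<noteq> {}"
proof -
  have "infinite (UNIV :: (real^2) set)"
    using not_bounded_UNIV finite_imp_bounded by blast
  then obtain P :: "(real^2) set" where "finite P" "card P = n"
    using infinite_arbitrarily_large by blast
  then show ?thesis by blast
qed

end

theory Submission
  imports Defs
begin

text \<open>
  The points are placed on horizontal lines at distance 116, at all integer abscissae of a long
  range, together with one isolated point in the middle of each 117 by 116 cell between two
  lines. A disk that meets points of two different lines, or an isolated point and another point,
  has radius at least 29; call it big. A small disk covers at most two points, so covering an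
  isolated point by its own disk wastes one half of a disk. To avoid this waste one needs a big
  disk, and a big disk touching a line forces some of the neighbouring points of the line to be
  covered by disks of their own: at these points a disk through two neighbours must be flat on
  the side of the big disk, hence large on the other side, and two such disks overlap. On every
  line there are at least as many singly covered points as points covered by big disks, up to a
  constant, so each cell of 118 points costs half a disk more than 59.
\<close>

section \<open>Labelled lines\<close>

text \<open>The distance from the midpoint of the pair {p, p + 1} to the midpoint of the unit interval
  that ends in x and lies on the other side of x. Among the positions allowed to the chord of an
  empty disk through x, this interval is the one that restricts disks through the pair least.\<close>

definition pair_dist :: "int \<Rightarrow> int \<Rightarrow> int" where
  "pair_dist x p = (if x < p then p - x + 1 else x - p)"

section \<open>Constraints on the pairs near big points\<close>

lemma mult_le_25:
  fixes a b :: int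
  assumes "a + b \<le> 10" "0 \<le> a" "0 \<le> b"
  shows "a * b \<le> 25"
proof -
  have "(a + b) * (a + b) \<le> 10 * 10" using assms by (intro mult_mono) auto
  moreover have "0 \<le> (a - b) * (a - b)" by simp
  ultimately show ?thesis by (simp add: algebra_simps)
qed

text \<open>The set PL contains the left ends p of the pairs {p, p + 1} covered by one small disk; U and D
  are the points covered by big disks with centre above and below the line. If the disk of a pair
  has radius r and its centre has height y, then t = r + y is its extent above the line and
  1 / (4 t) = r - y is its extent below.\<close>

locale labelled_line =
  fixes U D PL :: "int set" and t :: "int \<Rightarrow> real"
  assumes t_pos: "p \<in> PL \<Longrightarrow> t p > 0"
    and PL_Suc: "p \<in> PL \<Longrightarrow> p + 1 \<notin> PL"
    and UD_disjoint: "U \<inter> D = {}"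
    and UD_PL: "x \<in> U \<union> D \<Longrightarrow> x \<notin> PL \<and> x - 1 \<notin> PL"
    and U_sep: "x \<in> U \<Longrightarrow> y \<in> U \<Longrightarrow> \<bar>x - y\<bar> \<le> 1 \<or> \<bar>x - y\<bar> \<ge> 50"
    and D_sep: "x \<in> D \<Longrightarrow> y \<in> D \<Longrightarrow> \<bar>x - y\<bar> \<le> 1 \<or> \<bar>x - y\<bar> \<ge> 50"
    and U_t: "x \<in> U \<Longrightarrow> p \<in> PL \<Longrightarrow> 57 * t p \<le> (real_of_int (pair_dist x p))\<^sup>2 - 1/2"
    and D_t: "x \<in> D \<Longrightarrow> p \<in> PL \<Longrightarrow> 57 * (1 / (4 * t p)) \<le> (real_of_int (pair_dist x p))\<^sup>2 - 1/2"
    and PL_PL: "p \<in> PL \<Longrightarrow> p + 2 \<in> PL \<Longrightarrow> 1/56 \<le> t p * t (p + 2) \<and> t p * t (p + 2) \<le> 7/2"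
begin

text \<open>The complement is taken in all of the integers, so points beyond the ends of a finite
  line count as singles.\<close>

definition singles :: "int set" where
  "singles = - (U \<union> D \<union> PL \<union> {p. p - 1 \<in> PL})"

text \<open>Mirroring the line swaps \<open>U\<close> with \<open>D\<close> and the two extents of a
  disk. The extents have product 1/4, so \<open>t p * t (p + 2)\<close> turns into its inverse
  divided by 16, which exchanges the bounds 1/56 and 7/2.\<close>

lemma reflect: "labelled_line D U PL (\<lambda>p. 1 / (4 * t p))"
proof unfold_locales
  fix p assume p: "p \<in> PL" "p + 2 \<in> PL"
  let ?q = "t p * t (p + 2)"
  have q: "1/56 \<le> ?q" "?q \<le> 7/2" using PL_PL[OF p] by auto
  have e: "1 / (4 * t p) * (1 / (4 * t (p + 2))) = 1 / (16 * ?q)" by simp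
  show "1/56 \<le> 1 / (4 * t p) * (1 / (4 * t (p + 2))) \<and> 1 / (4 * t p) * (1 / (4 * t (p + 2))) \<le> 7/2"
    unfolding e using q by (auto simp: field_simps simp del: mult.commute)
qed (use t_pos PL_Suc UD_disjoint UD_PL U_sep D_sep U_t D_t in \<open>auto simp: Int_commute\<close>)

text \<open>Distances 2 and 4 occur when the two pairs fill the four points next to
  \<open>x\<close>. Then \<open>U_t\<close> limits the product of the upper extents to (7/2) (31/2)
  / 57^2, just below the lower bound 1/56 for adjacent pairs.\<close>

lemma not_two_pairs_U:
  assumes "x \<in> U" "p \<in> PL" "p + 2 \<in> PL"
    and d: "pair_dist x p = 2 \<and> pair_dist x (p + 2) = 4 \<or> pair_dist x p = 4 \<and> pair_dist x (p + 2) = 2"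
  shows False
proof -
  define a where "a = t p"
  define b where "b = t (p + 2)"
  have a: "a > 0" "57 * a \<le> (real_of_int (pair_dist x p))\<^sup>2 - 1/2"
    and b: "b > 0" "57 * b \<le> (real_of_int (pair_dist x (p + 2)))\<^sup>2 - 1/2"
    using U_t t_pos assms by (auto simp: a_def b_def)
  have "1/56 \<le> a * b" using PL_PL assms by (auto simp: a_def b_def)
  moreover from d have "(57 * a) * (57 * b) \<le> (7/2) * (31/2)"
  proof
    assume "pair_dist x p = 2 \<and> pair_dist x (p + 2) = 4"
    then show ?thesis using a b by (intro mult_mono) auto
  next
    assume "pair_dist x p = 4 \<and> pair_dist x (p + 2) = 2"
    then have "(57 * b) * (57 * a) \<le> (7/2) * (31/2)" using a b by (intro mult_mono) auto
    then show ?thesis by (simp add: mult_ac)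
  qed
  ultimately show False by simp
qed

lemma not_two_pairs:
  assumes "x \<in> U \<union> D" "p \<in> PL" "p + 2 \<in> PL"
    and "pair_dist x p = 2 \<and> pair_dist x (p + 2) = 4 \<or> pair_dist x p = 4 \<and> pair_dist x (p + 2) = 2"
  shows False
  using assms not_two_pairs_U labelled_line.not_two_pairs_U[OF reflect] by blast

text \<open>One big disk bounds the upper extent of the pair, the other one the lower extent, and
  the extents have product 1/4. Hence the product of the two distances is at least 57/2.\<close>

lemma not_between:
  assumes x: "x \<in> U" and y: "y \<in> D" and p: "p \<in> PL"
    and d: "pair_dist x p * pair_dist y p \<le> 25"
  shows False
proof -
  let ?a = "real_of_int (pair_dist x p)" and ?b = "real_of_int (pair_dist y p)"
  have t: "t p > 0" using t_pos p .
  have "57 * t p * (57 * (1 / (4 * t p))) \<le> (?a\<^sup>2 - 1/2) * (?b\<^sup>2 - 1/2)"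
    using U_t[OF x p] D_t[OF y p] t by (intro mult_mono) auto
  also have "57 * t p * (57 * (1 / (4 * t p))) = 3249/4" using t by simp
  finally have 1: "3249/4 \<le> (?a\<^sup>2 - 1/2) * (?b\<^sup>2 - 1/2)" .
  have a: "1/2 \<le> ?a\<^sup>2" and b: "1/2 \<le> ?b\<^sup>2"
    using U_t[OF x p] D_t[OF y p] t by (smt (verit) divide_pos_pos)+
  have "(?a\<^sup>2 - 1/2) * (?b\<^sup>2 - 1/2) \<le> ?a\<^sup>2 * ?b\<^sup>2"
    using a b by (intro mult_mono) auto
  also have "\<dots> = (?a * ?b)\<^sup>2" by (simp add: power_mult_distrib)
  also have "\<dots> \<le> 25\<^sup>2"
  proof (rule power_mono)
    have "?a * ?b = real_of_int (pair_dist x p * pair_dist y p)" by simp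
    also have "\<dots> \<le> real_of_int 25" using d of_int_le_iff by blast
    finally show "?a * ?b \<le> 25" by simp
    show "0 \<le> ?a * ?b" by (simp add: pair_dist_def)
  qed
  finally show False using 1 by simp
qed

section \<open>Singles around clusters of big points\<close>

lemma singlesI: "x \<notin> U \<Longrightarrow> x \<notin> D \<Longrightarrow> x \<notin> PL \<Longrightarrow> x - 1 \<notin> PL \<Longrightarrow> x \<in> singles"
  by (simp add: singles_def)

text \<open>If all four following points were paired, \<open>x + 1\<close> and \<open>x + 3\<close>
  would be left ends, because no pair contains \<open>x\<close>; these pairs have distances 2 and
  4.\<close>

lemma single_right:
  assumes x: "x \<in> U \<union> D" and empty: "(U \<union> D) \<inter> {x+1..x+4} = {}"
  shows "\<exists>s\<in>singles. x + 1 \<le> s \<and> s \<le> x + 4"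
proof (rule ccontr)
  assume "\<not> ?thesis"
  then have no: "s \<in> PL \<or> s - 1 \<in> PL" if "x + 1 \<le> s" "s \<le> x + 4" for s
    using that empty by (force simp: singles_def)
  have "x + 1 \<in> PL" using no[of "x + 1"] UD_PL[OF x] by simp
  moreover have "x + 3 \<in> PL" using no[of "x + 3"] PL_Suc[OF \<open>x + 1 \<in> PL\<close>] by simp
  ultimately show False
    using not_two_pairs[OF x, of "x + 1"] by (simp add: pair_dist_def add.assoc)
qed

lemma single_left:
  assumes x: "x \<in> U \<union> D" and empty: "(U \<union> D) \<inter> {x-4..x-1} = {}"
  shows "\<exists>s\<in>singles. x - 4 \<le> s \<and> s \<le> x - 1"
proof (rule ccontr)
  assume "\<not> ?thesis"
  then have no: "s \<in> PL \<or> s - 1 \<in> PL" if "x - 4 \<le> s" "s \<le> x - 1" for s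
    using that empty by (force simp: singles_def)
  have "x - 2 \<in> PL" using no[of "x - 1"] UD_PL[OF x] by simp
  moreover have "x - 4 \<in> PL"
    using no[of "x - 3"] PL_Suc[of "x - 3"] \<open>x - 2 \<in> PL\<close> by auto
  ultimately show False
    using not_two_pairs[OF x, of "x - 4"] by (simp add: pair_dist_def)
qed

text \<open>Big disks with centres on the same side of the line are far apart, so at most two big disks are
  close to each other. The zone of such a cluster, extended by four points on both sides, pays for
  the cluster.\<close>

lemma zone_U:
  assumes l: "l \<in> U" and left: "(U \<union> D) \<inter> {l-4..l-1} = {}"
  shows "\<exists>r\<in>U \<union> D. r \<ge> l \<and> (U \<union> D) \<inter> {r+1..r+8} = {} \<and>
    card ((U \<union> D) \<inter> {l..<r+5}) \<le> card (singles \<inter> {l-4..<r+5})"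
proof -
  \<comment> \<open>By \<open>U_sep\<close>, the only points of \<open>U\<close> shortly after
    \<open>l - 1\<close> are \<open>l\<close> and possibly \<open>l + 1\<close>, so
    \<open>{l..r}\<close> is the upper part of the cluster.\<close>
  define r where "r = (if l + 1 \<in> U then l + 1 else l)"
  have r: "r \<in> U" "l \<le> r" "r \<le> l + 1" using l by (auto simp: r_def)
  have Ul: "x \<in> {l..r}" if "x \<in> U" "l \<le> x" "x < l + 50" for x
  proof -
    have "x = l \<or> x = l + 1" using U_sep[OF that(1) l] that by auto
    then show ?thesis using that by (auto simp: r_def)
  qed
  have lrU: "{l..r} \<subseteq> U"
  proof
    fix x assume "x \<in> {l..r}"
    then have "x = l \<or> x = r" using r by auto
    then show "x \<in> U" using l r by auto
  qed
  obtain sl where sl: "sl \<in> singles" "l - 4 \<le> sl" "sl \<le> l - 1"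
    using single_left[of l] l left by auto
  show ?thesis
  proof (cases "D \<inter> {l..r+8} = {}")
    \<comment> \<open>Without a nearby lower disk the cluster has at most two points, and one single
      on either side pays for them.\<close>
    case True
    have empty: "(U \<union> D) \<inter> {r+1..r+8} = {}"
      using True Ul r by force
    then have "(U \<union> D) \<inter> {r+1..r+4} = {}" by auto
    then obtain sr where sr: "sr \<in> singles" "r + 1 \<le> sr" "sr \<le> r + 4"
      using single_right[of r] r by auto
    have "(U \<union> D) \<inter> {l..<r+5} \<subseteq> {l..r}"
      using True Ul r by force
    then have "card ((U \<union> D) \<inter> {l..<r+5}) \<le> card {l..r}"
      by (intro card_mono) auto
    also have "\<dots> \<le> card {sl, sr}" using r sl sr by auto
    also have "\<dots> \<le> card (singles \<inter> {l-4..<r+5})"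
      using sl sr r by (intro card_mono) auto
    finally show ?thesis using empty r by blast
  next
    case False
    \<comment> \<open>The cluster also has a lower part \<open>{d..r'}\<close> of at most two
      points, so four singles suffice.\<close>
    define d where "d = Min (D \<inter> {l..r+8})"
    have "d \<in> D \<inter> {l..r+8}" unfolding d_def using False by (intro Min_in) auto
    then have d: "d \<in> D" "l \<le> d" "d \<le> r + 8" by auto
    have dmin: "d \<le> x" if "x \<in> D" "l \<le> x" "x \<le> r + 8" for x
      unfolding d_def using that by (intro Min_le) auto
    have dr: "d > r" using d lrU UD_disjoint by (meson IntI atLeastAtMost_iff disjoint_iff not_le subset_eq)
    define r' where "r' = (if d + 1 \<in> D then d + 1 else d)"
    have r': "r' \<in> D" "d \<le> r'" "r' \<le> d + 1" using d by (auto simp: r'_def)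
    have Dd: "x \<in> {d..r'}" if "x \<in> D" "l \<le> x" "x < d + 50" for x
    proof -
      have "d \<le> x" using dmin[OF that(1,2)] d by linarith
      then have "x = d \<or> x = d + 1" using D_sep[OF that(1) d(1)] that by auto
      then show ?thesis using that by (auto simp: r'_def)
    qed
    have empty: "(U \<union> D) \<inter> {r'+1..r'+8} = {}"
    proof -
      have "x \<notin> U" if "x \<in> {r'+1..r'+8}" for x
        using Ul[of x] that r r' d dr by auto
      moreover have "x \<notin> D" if "x \<in> {r'+1..r'+8}" for x
        using Dd[of x] that r r' d dr by auto
      ultimately show ?thesis by blast
    qed
    then have "(U \<union> D) \<inter> {r'+1..r'+4} = {}" by auto
    then obtain sr where sr: "sr \<in> singles" "r' + 1 \<le> sr" "sr \<le> r' + 4"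
      using single_right[of r'] r' by auto
    have sub: "(U \<union> D) \<inter> {l..<r'+5} \<subseteq> {l..r} \<union> {d..r'}"
    proof
      fix x assume x: "x \<in> (U \<union> D) \<inter> {l..<r'+5}"
      then show "x \<in> {l..r} \<union> {d..r'}"
        using Ul[of x] Dd[of x] r r' d dr by auto
    qed
    have "card ((U \<union> D) \<inter> {l..<r'+5}) \<le> card ({l..r} \<union> {d..r'})"
      using sub by (intro card_mono) auto
    also have "\<dots> \<le> card {l..r} + card {d..r'}" by (rule card_Un_le)
    also have "\<dots> \<le> 4" using r r' by simp
    finally have B4: "card ((U \<union> D) \<inter> {l..<r'+5}) \<le> 4" .
    have "\<exists>Q\<subseteq>singles \<inter> {l-4..<r'+5}. card Q = 4"
    proof (cases "d \<ge> r + 3")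
      \<comment> \<open>No pair fits into the gap between the parts: its distances to
        \<open>r\<close> and \<open>d\<close> add up to \<open>d - r + 1\<close>, at most 9, so
        \<open>not_between\<close> applies. All points of the gap are singles, and there are at
        least two.\<close>
      case True
      have "x \<in> singles" if x: "r < x" "x < d" for x
      proof (rule singlesI)
        show "x \<notin> U" using Ul[of x] x r d by auto
        show "x \<notin> D" using Dd[of x] x r d by auto
        have no: "p \<notin> PL" if p: "r < p" "p + 1 < d" for p
        proof
          assume "p \<in> PL"
          moreover have "pair_dist r p * pair_dist d p \<le> 25"
            by (rule mult_le_25) (use p r d in \<open>auto simp: pair_dist_def\<close>)
          ultimately show False using not_between[OF r(1) d(1)] by blast
        qed
        show "x \<notin> PL"
        proof (cases "x + 1 < d")
          case False
          then have "d - 1 = x" using x by auto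
          then show ?thesis using UD_PL[of d] d by auto
        qed (use no x in auto)
        show "x - 1 \<notin> PL"
        proof (cases "x - 1 = r")
          case True
          then show ?thesis using UD_PL[of r] r by auto
        qed (use no x in auto)
      qed
      then have "r + 1 \<in> singles" "r + 2 \<in> singles" using True by auto
      then show ?thesis using sl sr r d r' dr True
        by (intro exI[of _ "{sl, r+1, r+2, sr}"]) auto
    next
      \<comment> \<open>The parts almost touch, so a pair just outside the cluster is close to an
        upper and a lower disk, with product of distances at most 18. The two nearest points on
        either side are therefore singles.\<close>
      case False
      have no_r: "p \<notin> PL" if "p = r' + 1 \<or> p = r' + 2" for p
      proof
        assume p: "p \<in> PL"
        have "pair_dist r p * pair_dist r' p \<le> 6 * 3"
          using that r r' d dr False by (intro mult_mono) (auto simp: pair_dist_def)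
        then show False using not_between[OF r(1) r'(1) p] by simp
      qed
      have no_l: "p \<notin> PL" if "p = l - 2 \<or> p = l - 3" for p
      proof
        assume p: "p \<in> PL"
        have "pair_dist l p * pair_dist d p \<le> 3 * 6"
          using that r r' d dr False by (intro mult_mono) (auto simp: pair_dist_def)
        then show False using not_between[OF l d(1) p] by simp
      qed
      have nb: "x \<notin> U" "x \<notin> D" if "x \<in> {r'+1, r'+2, l-1, l-2}" for x
      proof -
        have "x \<in> {r'+1..r'+8} \<or> x \<in> {l-4..l-1}" using that by auto
        then show "x \<notin> U" "x \<notin> D" using empty left by blast+
      qed
      have "r' + 1 \<in> singles" "r' + 2 \<in> singles" "l - 1 \<in> singles" "l - 2 \<in> singles"
        using nb no_r no_l UD_PL[of r'] r' UD_PL[of l] l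
        by (intro singlesI; force)+
      then show ?thesis using r r' dr
        by (intro exI[of _ "{l-2, l-1, r'+1, r'+2}"]) auto
    qed
    then obtain Q where Q: "Q \<subseteq> singles \<inter> {l-4..<r'+5}" "card Q = 4" by blast
    then have "4 \<le> card (singles \<inter> {l-4..<r'+5})" by (metis card_mono finite_Int finite_atLeastLessThan_int)
    then have "card ((U \<union> D) \<inter> {l..<r'+5}) \<le> card (singles \<inter> {l-4..<r'+5})" using B4 by simp
    then show ?thesis using empty r r' dr by (intro bexI[of _ r']) auto
  qed
qed

lemma singles_reflect: "labelled_line.singles D U PL = singles"
  unfolding singles_def labelled_line.singles_def[OF reflect] by (simp add: Un_commute)

lemma zone:
  assumes l: "l \<in> U \<union> D" and left: "(U \<union> D) \<inter> {l-4..l-1} = {}"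
  shows "\<exists>r\<in>U \<union> D. r \<ge> l \<and> (U \<union> D) \<inter> {r+1..r+8} = {} \<and>
    card ((U \<union> D) \<inter> {l..<r+5}) \<le> card (singles \<inter> {l-4..<r+5})"
  using zone_U labelled_line.zone_U[OF reflect] assms singles_reflect by (metis Un_iff sup_commute)

text \<open>Induction over the clusters from left to right. The eight empty points after
  \<open>r\<close> keep the zone \<open>{l - 4..<r + 5}\<close> disjoint from the next one, which
  starts four points before its cluster.\<close>

lemma count_from:
  assumes fin: "finite (U \<union> D)" and M: "\<And>x. x \<in> U \<union> D \<Longrightarrow> x < M - 4"
    and "(U \<union> D) \<inter> {a..<a+4} = {}"
  shows "card ((U \<union> D) \<inter> {a..}) \<le> card (singles \<inter> {a..<M})"
  using assms(3)
proof (induction "card ((U \<union> D) \<inter> {a..})" arbitrary: a rule: less_induct)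
  case less
  let ?B = "U \<union> D"
  show ?case
  proof (cases "?B \<inter> {a..} = {}")
    case False
    define l where "l = Min (?B \<inter> {a..})"
    have finB: "finite (?B \<inter> {x..})" for x using fin by auto
    have l: "l \<in> ?B" "a \<le> l"
      using Min_in[OF finB False] by (auto simp: l_def)
    have lmin: "l \<le> x" if "x \<in> ?B" "a \<le> x" for x
      unfolding l_def using that by (intro Min_le finB) auto
    have al: "a + 4 \<le> l" using l less.prems by force
    have "?B \<inter> {l-4..l-1} = {}" using lmin al by force
    then obtain r where r: "r \<in> ?B" "r \<ge> l" "?B \<inter> {r+1..r+8} = {}"
      "card (?B \<inter> {l..<r+5}) \<le> card (singles \<inter> {l-4..<r+5})"
      using zone[OF l(1)] by auto
    have rM: "r + 5 \<le> M" using M[OF r(1)] by simp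
    have "l \<in> ?B \<inter> {a..} - ?B \<inter> {r+5..}" using l r by simp
    moreover have "?B \<inter> {r+5..} \<subseteq> ?B \<inter> {a..}" using l r by auto
    ultimately have "?B \<inter> {r+5..} \<subset> ?B \<inter> {a..}" by blast
    then have "card (?B \<inter> {r+5..}) < card (?B \<inter> {a..})"
      by (intro psubset_card_mono finB)
    moreover have "?B \<inter> {r+5..<r+5+4} = {}" using r(3) by (auto simp: disjoint_iff)
    ultimately have IH: "card (?B \<inter> {r+5..}) \<le> card (singles \<inter> {r+5..<M})"
      by (rule less.hyps)
    have "?B \<inter> {a..} = ?B \<inter> {l..<r+5} \<union> ?B \<inter> {r+5..}"
      using lmin al r by force
    then have "card (?B \<inter> {a..}) \<le> card (?B \<inter> {l..<r+5}) + card (?B \<inter> {r+5..})"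
      by (metis card_Un_le)
    also have "\<dots> \<le> card (singles \<inter> {l-4..<r+5}) + card (singles \<inter> {r+5..<M})"
      using r(4) IH by simp
    also have "\<dots> = card (singles \<inter> {l-4..<r+5} \<union> singles \<inter> {r+5..<M})"
      by (intro card_Un_disjoint[symmetric]) auto
    also have "\<dots> \<le> card (singles \<inter> {a..<M})"
      using al rM r(2) by (intro card_mono) auto
    finally show ?thesis .
  qed simp
qed

text \<open>Zones reach at most four points beyond either end of the line, whence the 8.\<close>

lemma card_UD_le:
  assumes "U \<union> D \<subseteq> {0..<L}"
  shows "card (U \<union> D) \<le> card (singles \<inter> {0..<L}) + 8"
proof -
  have fin: "finite (U \<union> D)" using assms finite_subset by blast
  have "card (U \<union> D) = card ((U \<union> D) \<inter> {-4..})"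
    by (rule arg_cong[of _ _ card]) (use assms in force)
  also have "\<dots> \<le> card (singles \<inter> {-4..<L+4})"
    by (rule count_from[OF fin]) (use assms in force)+
  also have "\<dots> \<le> card (singles \<inter> {0..<L} \<union> ({-4..<0} \<union> {L..<L+4}))"
    by (intro card_mono) auto
  also have "\<dots> \<le> card (singles \<inter> {0..<L}) + card ({-4..<0} \<union> {L..<L+4})"
    by (rule card_Un_le)
  also have "card ({-4..<0} \<union> {L..<L+4}) \<le> card {-4..<0::int} + card {L..<L+4}"
    by (rule card_Un_le)
  finally show ?thesis by simp
qed

end

section \<open>Disjoint disks along a line\<close>

lemma abs_less_of_power2:
  fixes x y :: real
  assumes "x\<^sup>2 < y\<^sup>2" "0 < y"
  shows "\<bar>x\<bar> < y"
  by (rule power2_less_imp_less) (use assms in auto)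

text \<open>For the products \<open>q\<close> of the upper and \<open>s\<close> of the lower
  extents, \<open>q * s\<close> is 1/16. Disjointness, with centres two apart along the line,
  becomes \<open>q + s \<le> 7/2\<close>, and both claims follow.\<close>

lemma pair_pair_bound:
  fixes y1 y2 r1 r2 :: real
  assumes 1: "r1 > 0" "r1\<^sup>2 = y1\<^sup>2 + 1/4" and 2: "r2 > 0" "r2\<^sup>2 = y2\<^sup>2 + 1/4"
    and d: "(r1 + r2)\<^sup>2 \<le> 4 + (y1 - y2)\<^sup>2"
  shows "1/56 \<le> (r1 + y1) * (r2 + y2)" "(r1 + y1) * (r2 + y2) \<le> 7/2"
proof -
  have "y1\<^sup>2 < r1\<^sup>2" "y2\<^sup>2 < r2\<^sup>2" using 1 2 by auto
  then have lt: "\<bar>y1\<bar> < r1" "\<bar>y2\<bar> < r2"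
    using 1 2 abs_less_of_power2 by blast+
  define q where "q = (r1 + y1) * (r2 + y2)"
  define s where "s = (r1 - y1) * (r2 - y2)"
  have "q > 0" "s > 0" using lt by (auto simp: q_def s_def intro!: mult_pos_pos)
  have "(r1 + y1) * (r1 - y1) = 1/4" "(r2 + y2) * (r2 - y2) = 1/4"
    using 1 2 by (simp_all add: power2_eq_square algebra_simps)
  then have "((r1 + y1) * (r1 - y1)) * ((r2 + y2) * (r2 - y2)) = 1/4 * (1/4)"
    by (simp only:)
  then have qs: "q * s = 1/16" by (simp add: q_def s_def mult_ac)
  have "q + s \<le> 7/2"
    using d 1 2 by (simp add: q_def s_def power2_eq_square algebra_simps)
  then have "q \<le> 7/2" "s \<le> 7/2" using \<open>q > 0\<close> \<open>s > 0\<close> by auto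
  moreover have "q * s \<le> q * (7/2)" using \<open>s \<le> 7/2\<close> \<open>q > 0\<close> by simp
  ultimately show "1/56 \<le> (r1 + y1) * (r2 + y2)" "(r1 + y1) * (r2 + y2) \<le> 7/2"
    using qs by (auto simp: q_def)
qed

text \<open>The offset \<open>u\<close> costs \<open>Y\<^sup>2\<close> at most 1/4, little against
  \<open>R\<^sup>2\<close>. The ratio 57/58 turns the radius 29 into the height 57/2.\<close>

lemma big_height:
  fixes u Y R :: real
  assumes "R \<ge> 29" "u\<^sup>2 + Y\<^sup>2 = R\<^sup>2" "\<bar>u\<bar> \<le> 1/2"
  shows "57 * R \<le> 58 * \<bar>Y\<bar>" "\<bar>Y\<bar> \<le> R"
proof -
  have u: "u\<^sup>2 \<le> (1/2)\<^sup>2" using power_mono[OF assms(3), of 2] by simp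
  have "29\<^sup>2 \<le> R\<^sup>2" using assms by (intro power_mono) auto
  then have "(57 * R)\<^sup>2 \<le> (58 * Y)\<^sup>2"
    using u assms by (simp add: power_mult_distrib power_divide)
  then have "\<bar>57 * R\<bar> \<le> \<bar>58 * Y\<bar>" by (simp only: abs_le_square_iff)
  then show "57 * R \<le> 58 * \<bar>Y\<bar>" by (simp add: abs_mult)
  have "Y\<^sup>2 \<le> R\<^sup>2" using assms by (metis le_add_same_cancel2 zero_le_power2)
  then have "\<bar>Y\<bar> \<le> \<bar>R\<bar>" by (simp only: abs_le_square_iff)
  then show "\<bar>Y\<bar> \<le> R" using assms by simp
qed

text \<open>Here \<open>d - 1/2 - v\<close> is the horizontal distance of the centres. Expanding
  disjointness with the worst offset \<open>v\<close> = -1/2 leaves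
  \<open>2 * (R * q + Y * y) \<le> d\<^sup>2 - 1/2\<close>, where \<open>R\<close> and
  \<open>Y\<close> are at least 57/2.\<close>

lemma big_pair_bound:
  fixes u v d Y R y q :: real
  assumes big: "R \<ge> 29" "u\<^sup>2 + Y\<^sup>2 = R\<^sup>2" "\<bar>u\<bar> \<le> 1/2" "Y > 0"
    and pair: "q > 0" "q\<^sup>2 = y\<^sup>2 + 1/4"
    and v: "v = u \<or> v = - u" and d: "d \<ge> 1/2"
    and disj: "(R + q)\<^sup>2 \<le> (d - 1/2 - v)\<^sup>2 + (Y - y)\<^sup>2"
  shows "57 * (q + y) \<le> d\<^sup>2 - 1/2"
proof -
  have Y: "57 * R \<le> 58 * Y" "Y \<le> R" using big_height[OF big(1-3)] big(4) by auto
  have v2: "v\<^sup>2 = u\<^sup>2" "- v \<le> 1/2" using v big by auto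
  have "(- v) * (2 * d - 1) \<le> (1/2) * (2 * d - 1)"
    using v2 d by (intro mult_right_mono) auto
  then have "2 * (R * q + Y * y) \<le> d\<^sup>2 - 1/2"
    using disj v2 big(2) pair(2) by (simp add: power2_eq_square algebra_simps)
  moreover have "57 * (q + y) \<le> 2 * (R * q + Y * y)"
  proof (cases "y \<ge> 0")
    case True
    have "(57/2) * q \<le> R * q" using big pair by (intro mult_right_mono) auto
    moreover have "(57/2) * y \<le> Y * y" using big Y True by (intro mult_right_mono) auto
    ultimately show ?thesis by (simp add: algebra_simps)
  next
    case False
    have "y\<^sup>2 < q\<^sup>2" using pair by simp
    then have "\<bar>y\<bar> < q" using pair(1) by (rule abs_less_of_power2)
    then have "29 * (q + y) \<le> R * (q + y)" using big by (intro mult_right_mono) auto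
    \<comment> \<open>For negative \<open>y\<close>, replacing \<open>Y\<close> by the larger
      \<open>R\<close> only lowers the sum, to \<open>R * (q + y)\<close>.\<close>
    moreover have "R * y \<le> Y * y" using Y False by (intro mult_right_mono_neg) auto
    ultimately show ?thesis using \<open>\<bar>y\<bar> < q\<close> by (simp add: algebra_simps)
  qed
  ultimately show ?thesis by linarith
qed

text \<open>With both centres on one side, \<open>Y1 * Y2\<close> is positive and disjointness
  forces \<open>D\<^sup>2\<close> up to at least 2 * 29^2 + 2 * 28^2 > 51^2.\<close>

lemma big_big_dist:
  fixes D u1 Y1 R1 u2 Y2 R2 :: real
  assumes 1: "R1 \<ge> 29" "u1\<^sup>2 + Y1\<^sup>2 = R1\<^sup>2" "\<bar>u1\<bar> \<le> 1/2"
    and 2: "R2 \<ge> 29" "u2\<^sup>2 + Y2\<^sup>2 = R2\<^sup>2" "\<bar>u2\<bar> \<le> 1/2"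
    and same: "Y1 > 0 \<and> Y2 > 0 \<or> Y1 < 0 \<and> Y2 < 0"
    and disj: "(R1 + R2)\<^sup>2 \<le> D\<^sup>2 + (Y1 - Y2)\<^sup>2"
  shows "\<bar>D\<bar> \<ge> 51"
proof -
  have "28 \<le> \<bar>Y1\<bar>" "28 \<le> \<bar>Y2\<bar>" using big_height[OF 1] big_height[OF 2] 1 2 by auto
  then have "28 * 28 \<le> \<bar>Y1\<bar> * \<bar>Y2\<bar>" by (intro mult_mono) auto
  also have "\<bar>Y1\<bar> * \<bar>Y2\<bar> = Y1 * Y2" using same by (auto simp: abs_if)
  finally have Y: "28 * 28 \<le> Y1 * Y2" .
  have R: "29 * 29 \<le> R1 * R2" using 1 2 by (intro mult_mono) auto
  have "D\<^sup>2 \<ge> 2 * (R1 * R2) + 2 * (Y1 * Y2) + u1\<^sup>2 + u2\<^sup>2"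
    using disj 1(2) 2(2) by (simp add: power2_eq_square algebra_simps)
  moreover have "0 \<le> u1\<^sup>2" "0 \<le> u2\<^sup>2" "51\<^sup>2 = (2601::real)" by simp_all
  ultimately have "51\<^sup>2 \<le> D\<^sup>2" using Y R by linarith
  then have "\<bar>51\<bar> \<le> \<bar>D\<bar>" by (simp only: abs_le_square_iff)
  then show ?thesis by simp
qed

text \<open>The coordinates X K and Y K of the centre of K are relative to the line, whose points
  0, ..., L - 1 are assigned to the disks by a.\<close>

locale disks_on_line =
  fixes X Y R :: "'k \<Rightarrow> real" and F Big :: "'k set" and L :: int and a :: "int \<Rightarrow> 'k"
  assumes R_pos: "K \<in> F \<Longrightarrow> R K > 0"
    and a_F: "i \<in> {0..<L} \<Longrightarrow> a i \<in> F"
    and on: "i \<in> {0..<L} \<Longrightarrow> (X (a i) - of_int i)\<^sup>2 + (Y (a i))\<^sup>2 = (R (a i))\<^sup>2"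
    and empty: "K \<in> F \<Longrightarrow> i \<in> {0..<L} \<Longrightarrow> (R K)\<^sup>2 \<le> (X K - of_int i)\<^sup>2 + (Y K)\<^sup>2"
    and disj: "K \<in> F \<Longrightarrow> K' \<in> F \<Longrightarrow> K \<noteq> K' \<Longrightarrow> (R K + R K')\<^sup>2 \<le> (X K - X K')\<^sup>2 + (Y K - Y K')\<^sup>2"
    and big: "K \<in> Big \<Longrightarrow> R K \<ge> 29"
begin

section \<open>Points of one line that share a disk\<close>

lemma center_between:
  assumes "i \<in> {0..<L}" "j \<in> {0..<L}" "i \<noteq> j" "a i = a j"
  shows "2 * X (a i) = of_int i + of_int j"
proof -
  have "(X (a i) - of_int i)\<^sup>2 = (X (a i) - of_int j)\<^sup>2"
    using on[OF assms(1)] on[OF assms(2)] assms(4) by simp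
  then have "(of_int i - of_int j) * (2 * X (a i) - of_int i - of_int j) = (0::real)"
    by (simp add: power2_eq_square algebra_simps)
  then show ?thesis using assms(3) by simp
qed

text \<open>The centre lies over the midpoint of \<open>i\<close> and \<open>j\<close>, and the
  neighbour \<open>i + 1\<close>, not being interior, keeps it at most 1/2 to the right of
  \<open>i\<close>.\<close>

lemma fibre_consecutive:
  assumes "i \<in> {0..<L}" "j \<in> {0..<L}" "i < j" "a i = a j"
  shows "j = i + 1"
proof -
  have c: "2 * X (a i) = of_int i + of_int j" using center_between assms by simp
  have "i + 1 \<in> {0..<L}" using assms by auto
  from empty[OF a_F[OF assms(1)] this] on[OF assms(1)]
  have "2 * X (a i) \<le> 2 * of_int i + 1" by (simp add: power2_eq_square algebra_simps)
  then have "real_of_int j \<le> of_int (i + 1)" using c by simp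
  then show ?thesis using assms(3) by (simp only: of_int_le_iff)
qed

lemma card_fibre: "card {i \<in> {0..<L}. a i = K} \<le> 2"
proof (cases "{i \<in> {0..<L}. a i = K} = {}")
  case False
  define l where "l = Min {i \<in> {0..<L}. a i = K}"
  have fin: "finite {i \<in> {0..<L}. a i = K}" by (rule finite_subset[of _ "{0..<L}"]) auto
  have l: "l \<in> {0..<L}" "a l = K" using Min_in[OF fin False] by (auto simp: l_def)
  have "{i \<in> {0..<L}. a i = K} \<subseteq> {l, l + 1}"
  proof
    fix i assume i: "i \<in> {i \<in> {0..<L}. a i = K}"
    then have "l \<le> i" unfolding l_def by (intro Min_le fin)
    then show "i \<in> {l, l + 1}" using fibre_consecutive[of l i] l i by (cases "l = i") auto
  qed
  then have "card {i \<in> {0..<L}. a i = K} \<le> card {l, l + 1}" by (intro card_mono) auto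
  also have "\<dots> \<le> 2" by simp
  finally show ?thesis .
qed (simp only: card.empty)

text \<open>At the two ends of the line the chord of a big disk can extend beyond the line, so the disks
  covering the end points are set aside.\<close>

definition core :: "int set" where
  "core = {i \<in> {0..<L}. a i \<in> Big \<and> a i \<noteq> a 0 \<and> a i \<noteq> a (L - 1)}"

definition pairs :: "int set" where
  "pairs = {i. 0 \<le> i \<and> i + 1 < L \<and> a i = a (i + 1) \<and> a i \<notin> Big}"

text \<open>A core point is not an end of the line, so it has neighbours on both sides, and neither
  is interior to the disk.\<close>

lemma core_offset: "i \<in> core \<Longrightarrow> \<bar>X (a i) - of_int i\<bar> \<le> 1/2"
proof -
  assume i: "i \<in> core"
  then have i': "i \<in> {0..<L}" and ne: "i \<noteq> 0" "i \<noteq> L - 1" by (auto simp: core_def)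
  then have "i + 1 \<in> {0..<L}" "i - 1 \<in> {0..<L}" by auto
  from this[THEN empty[OF a_F[OF i']]] on[OF i']
  have "2 * X (a i) - 2 * of_int i \<le> 1" "2 * of_int i - 2 * X (a i) \<le> 1"
    by (simp_all add: power2_eq_square algebra_simps)
  then show ?thesis by linarith
qed

lemma core_disk:
  assumes "i \<in> core"
  shows "R (a i) \<ge> 29" "(X (a i) - of_int i)\<^sup>2 + (Y (a i))\<^sup>2 = (R (a i))\<^sup>2" "a i \<in> F"
  using assms on big a_F by (auto simp: core_def)

lemma core_Y: "i \<in> core \<Longrightarrow> Y (a i) \<noteq> 0"
  using big_height[OF core_disk(1,2) core_offset] core_disk by force

lemma pair_disk:
  assumes "p \<in> pairs"
  shows "X (a p) = of_int p + 1/2" "(R (a p))\<^sup>2 = (Y (a p))\<^sup>2 + 1/4" "R (a p) > 0" "a p \<in> F"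
    "\<bar>Y (a p)\<bar> < R (a p)"
proof -
  have p: "p \<in> {0..<L}" "p + 1 \<in> {0..<L}" "a p = a (p + 1)" using assms by (auto simp: pairs_def)
  show X: "X (a p) = of_int p + 1/2" using center_between[of p "p + 1"] p by simp
  show R: "(R (a p))\<^sup>2 = (Y (a p))\<^sup>2 + 1/4"
    using on[OF p(1)] X by (simp add: power2_eq_square)
  show "R (a p) > 0" "a p \<in> F" using a_F p R_pos by auto
  have "(Y (a p))\<^sup>2 < (R (a p))\<^sup>2" using R by simp
  then show "\<bar>Y (a p)\<bar> < R (a p)" using \<open>R (a p) > 0\<close> by (rule abs_less_of_power2)
qed

lemma pair_inverse:
  assumes "p \<in> pairs"
  shows "1 / (4 * (R (a p) + Y (a p))) = R (a p) - Y (a p)"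
proof -
  have "(R (a p) - Y (a p)) * (R (a p) + Y (a p)) = 1/4"
    using pair_disk(2)[OF assms] by (simp add: power2_eq_square algebra_simps)
  then show ?thesis using pair_disk(5)[OF assms] by (simp add: field_simps)
qed

lemma core_pair_bound:
  assumes x: "x \<in> core" and p: "p \<in> pairs"
  shows "Y (a x) > 0 \<Longrightarrow> 57 * (R (a p) + Y (a p)) \<le> (of_int (pair_dist x p))\<^sup>2 - 1/2"
    and "Y (a x) < 0 \<Longrightarrow> 57 * (R (a p) - Y (a p)) \<le> (of_int (pair_dist x p))\<^sup>2 - 1/2"
proof -
  define u where "u = X (a x) - of_int x"
  \<comment> \<open>With this sign, \<open>v\<close> measures the shift of the big centre towards
    the pair, whichever side the pair is on.\<close>
  define v where "v = (if x < p then u else - u)"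
  have ne: "a x \<noteq> a p" using x p by (auto simp: core_def pairs_def)
  have v: "v = u \<or> v = - u" by (simp add: v_def)
  have xp: "x \<noteq> p" using x p by (auto simp: core_def pairs_def)
  have "pair_dist x p \<ge> 1" using xp by (auto simp: pair_dist_def)
  then have d: "real_of_int (pair_dist x p) \<ge> 1/2" by linarith
  have "(X (a x) - X (a p))\<^sup>2 = (of_int (pair_dist x p) - 1/2 - v)\<^sup>2"
    unfolding pair_disk(1)[OF p] v_def u_def pair_dist_def
    by (simp add: power2_eq_square algebra_simps)
  then have D: "(R (a x) + R (a p))\<^sup>2 \<le> (of_int (pair_dist x p) - 1/2 - v)\<^sup>2 + (Y (a x) - Y (a p))\<^sup>2"
    using disj[OF core_disk(3)[OF x] pair_disk(4)[OF p] ne] by simp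
  note c = core_disk[OF x, folded u_def] core_offset[OF x, folded u_def]
  show "57 * (R (a p) + Y (a p)) \<le> (of_int (pair_dist x p))\<^sup>2 - 1/2" if "Y (a x) > 0"
    using big_pair_bound[OF c(1,2,4) that pair_disk(3,2)[OF p] v d D] .
  show "57 * (R (a p) - Y (a p)) \<le> (of_int (pair_dist x p))\<^sup>2 - 1/2" if "Y (a x) < 0"
    using big_pair_bound[of "R (a x)" u "- Y (a x)" "R (a p)" "- Y (a p)" v] that c pair_disk(3,2)[OF p] v d D
    by (simp add: power2_commute)
qed

text \<open>One disk serves only consecutive points. Centres of different disks are at least 51
  apart along the line, and each offset costs at most 1/2.\<close>

lemma core_separated:
  assumes x: "x \<in> core" and y: "y \<in> core"
    and same: "Y (a x) > 0 \<and> Y (a y) > 0 \<or> Y (a x) < 0 \<and> Y (a y) < 0"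
  shows "\<bar>x - y\<bar> \<le> 1 \<or> \<bar>x - y\<bar> \<ge> 50"
proof (cases "a x = a y")
  case True
  then show ?thesis
    using fibre_consecutive[of x y] fibre_consecutive[of y x] x y
    by (cases x y rule: linorder_cases) (auto simp: core_def)
next
  case False
  have "\<bar>X (a x) - X (a y)\<bar> \<ge> 51"
    using big_big_dist[OF core_disk(1,2)[OF x] core_offset[OF x] core_disk(1,2)[OF y] core_offset[OF y] same]
      disj[OF core_disk(3)[OF x] core_disk(3)[OF y] False] by blast
  then have "\<bar>real_of_int x - of_int y\<bar> \<ge> 50"
    using core_offset[OF x] core_offset[OF y] by linarith
  then show ?thesis by linarith
qed

lemma core_labelled_line: "labelled_line {x \<in> core. Y (a x) > 0} {x \<in> core. Y (a x) < 0} pairs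
    (\<lambda>p. R (a p) + Y (a p))"
proof
  fix p assume p: "p \<in> pairs"
  show "R (a p) + Y (a p) > 0" using pair_disk(5)[OF p] by linarith
  show "p + 1 \<notin> pairs"
    using fibre_consecutive[of p "p + 1 + 1"] p by (auto simp: pairs_def)
  assume p2: "p + 2 \<in> pairs"
  have "a p \<noteq> a (p + 2)" using fibre_consecutive[of p "p + 2"] p p2 by (auto simp: pairs_def)
  from disj[OF pair_disk(4)[OF p] pair_disk(4)[OF p2] this]
  have "(R (a p) + R (a (p + 2)))\<^sup>2 \<le> 4 + (Y (a p) - Y (a (p + 2)))\<^sup>2"
    by (simp add: pair_disk(1)[OF p] pair_disk(1)[OF p2])
  from pair_pair_bound[OF pair_disk(3,2)[OF p] pair_disk(3,2)[OF p2] this]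
  show "1/56 \<le> (R (a p) + Y (a p)) * (R (a (p + 2)) + Y (a (p + 2))) \<and>
    (R (a p) + Y (a p)) * (R (a (p + 2)) + Y (a (p + 2))) \<le> 7/2" by simp
next
  fix x assume "x \<in> {x \<in> core. Y (a x) > 0} \<union> {x \<in> core. Y (a x) < 0}"
  then have "x \<in> core" by auto
  then show "x \<notin> pairs \<and> x - 1 \<notin> pairs" by (auto simp: core_def pairs_def)
qed (use core_pair_bound core_separated pair_inverse in auto)

text \<open>At most four points share a disk with an end of the line. They cost 4 among the big
  points and 4 among the singles; \<open>card_UD_le\<close> costs 8.\<close>

lemma card_big_le_card_single:
  "card {i \<in> {0..<L}. a i \<in> Big} \<le>
   card {i \<in> {0..<L}. a i \<notin> Big \<and> (\<forall>j\<in>{0..<L}. a j = a i \<longrightarrow> j = i)} + 16"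
proof -
  let ?E = "{i \<in> {0..<L}. a i = a 0} \<union> {i \<in> {0..<L}. a i = a (L - 1)}"
  let ?S1 = "{i \<in> {0..<L}. a i \<notin> Big \<and> (\<forall>j\<in>{0..<L}. a j = a i \<longrightarrow> j = i)}"
  interpret labelled_line "{x \<in> core. Y (a x) > 0}" "{x \<in> core. Y (a x) < 0}" pairs
    "\<lambda>p. R (a p) + Y (a p)" by (rule core_labelled_line)
  have core: "{x \<in> core. Y (a x) > 0} \<union> {x \<in> core. Y (a x) < 0} = core"
    using core_Y by force
  have E: "card ?E \<le> 4"
    using card_Un_le[of "{i \<in> {0..<L}. a i = a 0}" "{i \<in> {0..<L}. a i = a (L - 1)}"]
      card_fibre[of "a 0"] card_fibre[of "a (L - 1)"] by linarith
  have "finite (core \<union> ?E)"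
    by (rule finite_subset[of _ "{0..<L}"]) (auto simp: core_def)
  then have "card {i \<in> {0..<L}. a i \<in> Big} \<le> card (core \<union> ?E)"
    by (rule card_mono) (auto simp: core_def)
  also have "\<dots> \<le> card core + 4" using card_Un_le[of core ?E] E by linarith
  also have "card core \<le> card (singles \<inter> {0..<L}) + 8"
    by (rule card_UD_le[of L, unfolded core]) (auto simp: core_def)
  also have "card (singles \<inter> {0..<L}) \<le> card (?S1 \<union> ?E)"
  proof (intro card_mono subsetI)
    fix i assume i: "i \<in> singles \<inter> {0..<L}"
    then have "i \<notin> core" "i \<notin> pairs" "i - 1 \<notin> pairs"
      unfolding singles_def core by auto
    show "i \<in> ?S1 \<union> ?E"
    proof (cases "a i \<in> Big")
      case True
      then show ?thesis using \<open>i \<notin> core\<close> i by (auto simp: core_def)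
    next
      case False
      have "j = i" if j: "j \<in> {0..<L}" "a j = a i" for j
      proof (cases i j rule: linorder_cases)
        case less
        then have "j = i + 1" using fibre_consecutive[of i j] i j by auto
        then show ?thesis using \<open>i \<notin> pairs\<close> i j False by (auto simp: pairs_def)
      next
        case greater
        then have "j = i - 1" using fibre_consecutive[of j i] i j by auto
        then show ?thesis using \<open>i - 1 \<notin> pairs\<close> i j False by (auto simp: pairs_def)
      qed simp
      then show ?thesis using i False by auto
    qed
  qed (rule finite_subset[of _ "{0..<L}"], auto)
  also have "card (?S1 \<union> ?E) \<le> card ?S1 + 4" using card_Un_le[of ?S1 ?E] E by linarith
  finally show ?thesis by simp
qed

end

section \<open>Disks in the plane and the grid\<close>

lemma dist_vec2: "(dist p q)\<^sup>2 = (p $ 1 - q $ 1)\<^sup>2 + (p $ 2 - q $ 2)\<^sup>2" for p q :: "real^2"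
  by (simp add: dist_vec_def L2_set_def sum_2 dist_real_def)

text \<open>If the centres were closer, the point dividing their segment in the ratio r : s would
  lie in both balls.\<close>

lemma dist_ge_if_disjoint_balls:
  fixes c d :: "'a :: real_normed_vector"
  assumes "ball c r \<inter> ball d s = {}" "r > 0" "s > 0"
  shows "r + s \<le> dist c d"
proof (rule ccontr)
  assume *: "\<not> r + s \<le> dist c d"
  define u where "u = r / (r + s)"
  have u: "u \<ge> 0" "1 - u = s / (r + s)" using assms by (auto simp: u_def field_simps)
  define p where "p = c + u *\<^sub>R (d - c)"
  have "dist c p = u * dist c d" using u by (simp add: p_def dist_norm norm_minus_commute)
  also have "\<dots> < r"
    using * assms mult_strict_left_mono[of "dist c d" "r + s" r] by (simp add: u_def field_simps)
  finally have 1: "dist c p < r" .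
  have "d - p = (1 - u) *\<^sub>R (d - c)" by (simp add: p_def algebra_simps)
  then have "dist d p = \<bar>1 - u\<bar> * dist c d" by (simp add: dist_norm norm_minus_commute)
  also have "\<dots> < s" unfolding u(2)
    using * assms mult_strict_left_mono[of "dist c d" "r + s" s] by (simp add: field_simps)
  finally show False using 1 assms(1) by (auto simp: disjoint_iff)
qed

definition center :: "(real^2) set \<Rightarrow> real^2" where
  "center K = (SOME c. \<exists>r>0. K = cball c r)"

definition radius :: "(real^2) set \<Rightarrow> real" where
  "radius K = (SOME r. r > 0 \<and> K = cball (center K) r)"

lemma disk_eq:
  assumes "is_disk K"
  shows "radius K > 0" "K = cball (center K) (radius K)"
proof -
  have "\<exists>r>0. K = cball (center K) r"
    unfolding center_def by (rule someI_ex) (use assms is_disk_def in blast)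
  then have "radius K > 0 \<and> K = cball (center K) (radius K)"
    unfolding radius_def by (rule someI_ex)
  then show "radius K > 0" "K = cball (center K) (radius K)" by blast+
qed

lemma disk_frontier:
  assumes "is_disk K" "p \<in> frontier K"
  shows "(center K $ 1 - p $ 1)\<^sup>2 + (center K $ 2 - p $ 2)\<^sup>2 = (radius K)\<^sup>2"
proof -
  have "p \<in> sphere (center K) (radius K)"
    using assms(2) disk_eq[OF assms(1)] by (metis frontier_cball)
  then show ?thesis by (simp flip: dist_vec2)
qed

lemma disk_interior:
  assumes "is_disk K" "p \<notin> interior K"
  shows "(radius K)\<^sup>2 \<le> (center K $ 1 - p $ 1)\<^sup>2 + (center K $ 2 - p $ 2)\<^sup>2"
proof -
  have "p \<notin> ball (center K) (radius K)"
    using assms(2) disk_eq[OF assms(1)] by (metis interior_cball)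
  then show ?thesis
    unfolding dist_vec2[symmetric] using disk_eq(1)[OF assms(1)] by (intro power_mono) auto
qed

lemma disk_disjoint:
  assumes "is_disk K" "is_disk L" "interior K \<inter> interior L = {}"
  shows "(radius K + radius L)\<^sup>2 \<le>
    (center K $ 1 - center L $ 1)\<^sup>2 + (center K $ 2 - center L $ 2)\<^sup>2"
proof -
  have "ball (center K) (radius K) \<inter> ball (center L) (radius L) = {}"
    using assms disk_eq(2) by (metis interior_cball)
  then have "radius K + radius L \<le> dist (center K) (center L)"
    using disk_eq(1) assms by (intro dist_ge_if_disjoint_balls) auto
  then show ?thesis
    unfolding dist_vec2[symmetric] using disk_eq(1)[OF assms(1)] disk_eq(1)[OF assms(2)]
    by (intro power_mono) auto
qed

section \<open>The grid of lines and isolated points\<close>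

definition wall_point :: "int \<Rightarrow> int \<Rightarrow> real^2" where
  "wall_point j i = vector [of_int i, of_int (116 * j)]"

text \<open>The offset 58 is half the distance of the lines. The column width 117 slightly exceeds
  that distance, which \<open>level_chord\<close> exploits.\<close>

definition cell_point :: "int \<Rightarrow> int \<Rightarrow> real^2" where
  "cell_point j k = vector [of_int (117 * k + 58), of_int (116 * j + 58)]"

definition walls :: "nat \<Rightarrow> (real^2) set" where
  "walls m = (\<lambda>(j, i). wall_point j i) ` ({0..int m} \<times> {0..<117 * int m})"

definition cells :: "nat \<Rightarrow> (real^2) set" where
  "cells m = (\<lambda>(j, k). cell_point j k) ` ({0..<int m} \<times> {0..<int m})"

lemma wall_point_nth [simp]: "wall_point j i $ 1 = of_int i" "wall_point j i $ 2 = of_int (116 * j)"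
  by (simp_all add: wall_point_def)

lemma cell_point_nth [simp]:
  "cell_point j k $ 1 = of_int (117 * k + 58)" "cell_point j k $ 2 = of_int (116 * j + 58)"
  by (simp_all add: cell_point_def)

lemma wall_point_eq: "wall_point j i = wall_point j' i' \<longleftrightarrow> j = j' \<and> i = i'"
proof
  assume "wall_point j i = wall_point j' i'"
  then have "wall_point j i $ 1 = wall_point j' i' $ 1" "wall_point j i $ 2 = wall_point j' i' $ 2"
    by simp_all
  then show "j = j' \<and> i = i'" by (simp only: wall_point_nth of_int_eq_iff) simp
qed simp

lemma cell_point_eq: "cell_point j k = cell_point j' k' \<longleftrightarrow> j = j' \<and> k = k'"
proof
  assume "cell_point j k = cell_point j' k'"
  then have "cell_point j k $ 1 = cell_point j' k' $ 1" "cell_point j k $ 2 = cell_point j' k' $ 2"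
    by simp_all
  then show "j = j' \<and> k = k'" by (simp only: cell_point_nth of_int_eq_iff) simp
qed simp

lemma wall_point_ne_cell_point: "wall_point j i \<noteq> cell_point j' k"
proof
  assume "wall_point j i = cell_point j' k"
  then have "wall_point j i $ 2 = cell_point j' k $ 2" by simp
  then have "116 * j = 116 * j' + 58" by (simp only: wall_point_nth cell_point_nth of_int_eq_iff)
  then show False by presburger
qed

lemma inj_wall: "inj_on (\<lambda>(j, i). wall_point j i) A"
  by (auto simp: inj_on_def wall_point_eq)

lemma inj_cell: "inj_on (\<lambda>(j, i). cell_point j i) A"
  by (auto simp: inj_on_def cell_point_eq)

lemma finite_walls [simp]: "finite (walls m)" and finite_cells [simp]: "finite (cells m)"
  by (simp_all add: walls_def cells_def)

lemma walls_cells_disjoint: "walls m \<inter> cells m = {}"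
  using wall_point_ne_cell_point by (auto simp: walls_def cells_def)

lemma card_walls: "card (walls m) = (m + 1) * (117 * m)"
  unfolding walls_def
  by (subst card_image[OF inj_wall])
    (simp add: card_cartesian_product nat_mult_distrib nat_add_distrib)

lemma card_cells: "card (cells m) = m * m"
  unfolding cells_def by (subst card_image[OF inj_cell]) (simp add: card_cartesian_product)

text \<open>A disk through points on both sides of a line, at distance at least 58 from it, cuts the line in
  a long interval, since the power of the crossing point is at least the square of 58.\<close>

lemma chord_crossing:
  fixes px qx qy X Y r :: real and a b :: int
  assumes p: "(X - px)\<^sup>2 + (Y + 58)\<^sup>2 = r\<^sup>2" and q: "(X - qx)\<^sup>2 + (Y - qy)\<^sup>2 = r\<^sup>2"
    and qy: "qy \<ge> 58" and px: "of_int a \<le> px" "px \<le> of_int b" and qx: "of_int a \<le> qx" "qx \<le> of_int b"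
  shows "\<exists>i. a \<le> i \<and> i \<le> b \<and> (X - of_int i)\<^sup>2 + Y\<^sup>2 < r\<^sup>2"
proof -
  \<comment> \<open>The segment from \<open>(px, -58)\<close> to \<open>(qx, qy)\<close> meets
    height 0 at the abscissa \<open>z\<close>; \<open>l\<close> is the weight of its second
    end.\<close>
  define l where "l = 58 / (58 + qy)"
  define z where "z = (1 - l) * px + l * qx"
  have l: "0 \<le> l" "l \<le> 1" using qy by (auto simp: l_def field_simps)
  have ly: "l * (58 + qy) = 58" "(1 - l) * (58 + qy) = qy" using qy by (auto simp: l_def field_simps)
  have lq: "l * qy = 58 * (1 - l)" using ly by (simp add: algebra_simps)
  have "(1 - l) * of_int a + l * of_int a \<le> z" "z \<le> (1 - l) * of_int b + l * of_int b"
    unfolding z_def using l px qx by (intro add_mono mult_left_mono; simp)+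
  then have z: "of_int a \<le> z" "z \<le> of_int b" by (simp_all add: algebra_simps)
  \<comment> \<open>Weighting the two circle equations by \<open>1 - l\<close> and \<open>l\<close>
    cancels the mixed terms linear in \<open>Y\<close>.\<close>
  have "r\<^sup>2 = (1 - l) * ((X - px)\<^sup>2 + (Y + 58)\<^sup>2) + l * ((X - qx)\<^sup>2 + (Y - qy)\<^sup>2)"
    unfolding p q by (simp add: algebra_simps)
  also have "\<dots> = (X - z)\<^sup>2 + l * (1 - l) * (px - qx)\<^sup>2 + Y\<^sup>2 + 2 * Y * (58 * (1 - l) - l * qy)
      + (58 * (58 * (1 - l)) + l * qy * qy)"
    by (simp add: z_def power2_eq_square algebra_simps)
  also have "\<dots> = (X - z)\<^sup>2 + l * (1 - l) * (px - qx)\<^sup>2 + Y\<^sup>2 + 58 * ((1 - l) * (58 + qy))"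
    unfolding lq by (simp add: algebra_simps)
  also have "\<dots> = (X - z)\<^sup>2 + l * (1 - l) * (px - qx)\<^sup>2 + Y\<^sup>2 + 58 * qy"
    unfolding ly by simp
  finally have "r\<^sup>2 = (X - z)\<^sup>2 + l * (1 - l) * (px - qx)\<^sup>2 + Y\<^sup>2 + 58 * qy" .
  moreover have "0 \<le> l * (1 - l) * (px - qx)\<^sup>2" using l by simp
  ultimately have r: "(X - z)\<^sup>2 + Y\<^sup>2 + 58 * 58 \<le> r\<^sup>2" using qy by linarith
  \<comment> \<open>Rounding \<open>z\<close> towards \<open>X\<close> raises the squared distance
    to \<open>X\<close> by at most 1 and stays between \<open>a\<close> and
    \<open>b\<close>.\<close>
  show ?thesis
  proof (cases "z \<le> X")
    case True
    define i where "i = \<lceil>z\<rceil>"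
    have i: "z \<le> of_int i" "of_int i < z + 1" unfolding i_def by linarith+
    have "(X - of_int i)\<^sup>2 \<le> (X - z)\<^sup>2 + 1"
    proof (cases "of_int i \<le> X")
      case True
      then have "(X - of_int i)\<^sup>2 \<le> (X - z)\<^sup>2" using i by (intro power_mono) auto
      then show ?thesis by simp
    next
      case False
      then have "(of_int i - X)\<^sup>2 \<le> 1\<^sup>2" using i \<open>z \<le> X\<close> by (intro power_mono) auto
      then show ?thesis by (simp add: power2_commute add_increasing)
    qed
    moreover have "a \<le> i" "i \<le> b" unfolding i_def using z by linarith+
    ultimately show ?thesis using r by (intro exI[of _ i]) auto
  next
    case False
    define i where "i = \<lfloor>z\<rfloor>"
    have i: "of_int i \<le> z" "z - 1 < of_int i" unfolding i_def by linarith+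
    have "(X - of_int i)\<^sup>2 \<le> (X - z)\<^sup>2 + 1"
    proof (cases "X \<le> of_int i")
      case True
      then have "(of_int i - X)\<^sup>2 \<le> (z - X)\<^sup>2" using i by (intro power_mono) auto
      then show ?thesis by (simp add: power2_commute)
    next
      case not_le: False
      then have "(X - of_int i)\<^sup>2 \<le> 1\<^sup>2" using i False by (intro power_mono) auto
      then show ?thesis by (simp add: add_increasing)
    qed
    moreover have "a \<le> i" "i \<le> b" unfolding i_def using z by linarith+
    ultimately show ?thesis using r by (intro exI[of _ i]) auto
  qed
qed

lemma level_chord:
  fixes X Y r y :: real and a b :: int
  assumes a: "(X - of_int a)\<^sup>2 + (Y - y)\<^sup>2 = r\<^sup>2" and b: "(X - of_int b)\<^sup>2 + (Y - y)\<^sup>2 = r\<^sup>2"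
    and ab: "a + 117 \<le> b"
  shows "\<exists>i w. a \<le> i \<and> i \<le> b \<and> (w = y + 58 \<or> w = y - 58) \<and> (X - of_int i)\<^sup>2 + (Y - w)\<^sup>2 < r\<^sup>2"
proof -
  have "(of_int b - of_int a) * (2 * X - of_int (a + b)) = 0"
    using a b by (simp add: power2_eq_square algebra_simps)
  then have X: "2 * X = of_int (a + b)" using ab by simp
  define i where "i = (a + b) div 2"
  have i: "2 * i \<le> a + b" "a + b \<le> 2 * i + 1" unfolding i_def by presburger+
  define w where "w = (if Y \<ge> y then y + 58 else y - 58)"
  have "\<bar>X - of_int i\<bar> \<le> 1/2" using X i by linarith
  then have Xi: "(X - of_int i)\<^sup>2 \<le> 1/4" using power_mono[of "\<bar>X - of_int i\<bar>" "1/2" 2]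
    by (simp add: power_divide)
  have "real_of_int a + 117 \<le> of_int b" using ab by linarith
  then have "117/2 \<le> X - of_int a" using X by (simp add: field_simps)
  then have "(117/2)\<^sup>2 \<le> (X - of_int a)\<^sup>2" by (intro power_mono) auto
  moreover have "(Y - w)\<^sup>2 \<le> (Y - y)\<^sup>2 + 58\<^sup>2"
    by (auto simp: w_def power2_eq_square algebra_simps)
  ultimately have "(X - of_int i)\<^sup>2 + (Y - w)\<^sup>2 < r\<^sup>2"
    using a Xi by (simp add: power_divide)
  then show ?thesis using i ab by (intro exI[of _ i] exI[of _ w]) (auto simp: w_def)
qed

text \<open>Isolated points of different rows are separated by a line, and
  \<open>chord_crossing\<close> finds one of its points inside the disk; for points of one row
  \<open>level_chord\<close> does.\<close>

lemma unique_cell_point_on_empty_disk: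
  assumes disk: "is_disk K" and empty: "interior K \<inter> walls m = {}"
    and p: "p \<in> cells m" "p \<in> frontier K" and q: "q \<in> cells m" "q \<in> frontier K"
  shows "p = q"
proof (rule ccontr)
  assume "p \<noteq> q"
  obtain j k where p': "p = cell_point j k" "0 \<le> j" "j < int m" "0 \<le> k" "k < int m"
    using p by (auto simp: cells_def)
  obtain j' k' where q': "q = cell_point j' k'" "0 \<le> j'" "j' < int m" "0 \<le> k'" "k' < int m"
    using q by (auto simp: cells_def)
  let ?X = "center K $ 1" and ?Y = "center K $ 2" and ?r = "radius K"
  have outside: "?r\<^sup>2 \<le> (?X - of_int i)\<^sup>2 + (?Y - of_int (116 * l))\<^sup>2"
    if "0 \<le> i" "i < 117 * int m" "0 \<le> l" "l \<le> int m" for i l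
  proof -
    have "wall_point l i \<in> walls m" using that by (auto simp: walls_def)
    then have "wall_point l i \<notin> interior K" using empty by blast
    from disk_interior[OF disk this] show ?thesis by simp
  qed
  \<comment> \<open>Stated for fresh indices to serve both orders of the two points; the first
    premise says that \<open>(j, k)\<close> comes first.\<close>
  have *: False
    if prems: "\<not> (j < j' \<or> j = j' \<and> k < k') \<Longrightarrow> False"
     "(?X - of_int (117 * k + 58))\<^sup>2 + (?Y - of_int (116 * j + 58))\<^sup>2 = ?r\<^sup>2"
     "(?X - of_int (117 * k' + 58))\<^sup>2 + (?Y - of_int (116 * j' + 58))\<^sup>2 = ?r\<^sup>2"
     "0 \<le> j" "j < int m" "0 \<le> k" "k < int m" "0 \<le> j'" "j' < int m" "0 \<le> k'" "k' < int m"
    for j k j' k'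
  proof (cases "j < j'")
    case True
    have "\<exists>i. 0 \<le> i \<and> i \<le> 117 * int m - 1 \<and> (?X - of_int i)\<^sup>2 + (?Y - of_int (116 * (j + 1)))\<^sup>2 < ?r\<^sup>2"
    proof (rule chord_crossing)
      show "(?X - of_int (117 * k + 58))\<^sup>2 + (?Y - of_int (116 * (j + 1)) + 58)\<^sup>2 = ?r\<^sup>2"
        using prems(2) by (simp add: algebra_simps)
      show "(?X - of_int (117 * k' + 58))\<^sup>2
          + (?Y - of_int (116 * (j + 1)) - of_int (116 * j' + 58 - 116 * (j + 1)))\<^sup>2 = ?r\<^sup>2"
        using prems(3) by (simp add: algebra_simps)
      have "58 \<le> 116 * j' + 58 - 116 * (j + 1)" using True by simp
      then show "58 \<le> real_of_int (116 * j' + 58 - 116 * (j + 1))" by linarith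
      show "of_int 0 \<le> real_of_int (117 * k + 58)" "of_int 0 \<le> real_of_int (117 * k' + 58)"
        "real_of_int (117 * k + 58) \<le> of_int (117 * int m - 1)"
        "real_of_int (117 * k' + 58) \<le> of_int (117 * int m - 1)"
        using prems(4-) by (simp_all only: of_int_le_iff)
    qed
    then show False using outside[of _ "j + 1"] prems True by force
  next
    case False
    then have jk: "j' = j" "k < k'" using prems(1) by auto
    obtain i w where iw: "117 * k + 58 \<le> i" "i \<le> 117 * k' + 58"
      "w = of_int (116 * j + 58) + 58 \<or> w = real_of_int (116 * j + 58) - 58"
      "(?X - of_int i)\<^sup>2 + (?Y - w)\<^sup>2 < ?r\<^sup>2"
      using level_chord[OF prems(2) prems(3)[unfolded jk]] jk by auto
    have "\<exists>l. 0 \<le> l \<and> l \<le> int m \<and> w = of_int (116 * l)"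
      using iw(3)
    proof
      assume "w = of_int (116 * j + 58) + 58"
      then show ?thesis using prems by (intro exI[of _ "j + 1"]) simp
    next
      assume "w = of_int (116 * j + 58) - 58"
      then show ?thesis using prems by (intro exI[of _ j]) simp
    qed
    then obtain l where "0 \<le> l" "l \<le> int m" "w = of_int (116 * l)" by blast
    then show False using outside[of i l] iw prems by force
  qed
  have P: "(?X - of_int (117 * k + 58))\<^sup>2 + (?Y - of_int (116 * j + 58))\<^sup>2 = ?r\<^sup>2"
    using disk_frontier[OF disk p(2)] by (simp add: p'(1))
  have Q: "(?X - of_int (117 * k' + 58))\<^sup>2 + (?Y - of_int (116 * j' + 58))\<^sup>2 = ?r\<^sup>2"
    using disk_frontier[OF disk q(2)] by (simp add: q'(1))
  have "j \<noteq> j' \<or> k \<noteq> k'" using \<open>p \<noteq> q\<close> p' q' by auto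
  then consider "j < j' \<or> j = j' \<and> k < k'" | "j' < j \<or> j' = j \<and> k' < k" by linarith
  then show False
  proof cases
    case 1
    then show ?thesis using *[OF _ P Q p'(2-) q'(2-)] by blast
  next
    case 2
    then show ?thesis using *[OF _ Q P q'(2-) p'(2-)] by blast
  qed
qed

section \<open>Weights and the bound for the grid\<close>

locale grid_cover =
  fixes m :: nat and F :: "(real^2) set set" and f :: "real^2 \<Rightarrow> (real^2) set"
  assumes cover: "disk_cover (walls m \<union> cells m) F"
    and f: "p \<in> walls m \<union> cells m \<Longrightarrow> f p \<in> F \<and> p \<in> frontier (f p)"
begin

abbreviation "P \<equiv> walls m \<union> cells m"

text \<open>Only the disk selected by \<open>f\<close> counts for a point, so the fibres are
  disjoint even when a point lies on several disks.\<close>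

definition fibre :: "(real^2) set \<Rightarrow> (real^2) set" where
  "fibre K = {p \<in> P. f p = K}"

definition Big :: "(real^2) set set" where
  "Big = {K \<in> F. \<exists>p\<in>fibre K. \<exists>q\<in>fibre K. p \<noteq> q \<and> (p $ 2 \<noteq> q $ 2 \<or> p \<in> cells m)}"

lemma disks: "K \<in> F \<Longrightarrow> is_disk K" and empty: "K \<in> F \<Longrightarrow> interior K \<inter> P = {}"
  and finF: "finite F"
  and disj: "K \<in> F \<Longrightarrow> L \<in> F \<Longrightarrow> K \<noteq> L \<Longrightarrow> interior K \<inter> interior L = {}"
  using cover by (auto simp: disk_cover_def empty_disk_def pairwise_def)

lemma finite_fibre: "finite (fibre K)"
  by (rule finite_subset[of _ P]) (auto simp: fibre_def)

text \<open>All heights are multiples of 58, odd ones exactly for isolated points. Equal heights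
  leave two isolated points of one row, at least 117 apart.\<close>

lemma far_apart:
  assumes "p \<in> P" "q \<in> P" "p \<noteq> q" "p $ 2 \<noteq> q $ 2 \<or> p \<in> cells m"
  shows "dist p q \<ge> 58"
proof -
  have ht: "\<exists>h. x $ 2 = of_int (58 * h) \<and> (x \<in> cells m \<longleftrightarrow> odd h)" if x: "x \<in> P" for x
  proof (cases "x \<in> cells m")
    case True
    then obtain j k where "x = cell_point j k" by (auto simp: cells_def)
    then show ?thesis using True by (intro exI[of _ "2 * j + 1"]) simp
  next
    case False
    then obtain j i where "x = wall_point j i" using x by (auto simp: walls_def)
    then show ?thesis using False by (intro exI[of _ "2 * j"]) simp
  qed
  obtain g where g: "p $ 2 = of_int (58 * g)" "p \<in> cells m \<longleftrightarrow> odd g" using ht assms by blast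
  obtain h where h: "q $ 2 = of_int (58 * h)" "q \<in> cells m \<longleftrightarrow> odd h" using ht assms by blast
  show ?thesis
  proof (cases "g = h")
    case False
    then have "58 \<le> \<bar>58 * g - 58 * h\<bar>" by linarith
    then have "58 \<le> \<bar>(p - q) $ 2\<bar>" using g h by simp
    also have "\<dots> \<le> dist p q" unfolding dist_norm by (rule component_le_norm_cart)
    finally show ?thesis .
  next
    case True
    then have "p \<in> cells m" "q \<in> cells m" using assms(4) g h by auto
    then obtain j k j' k' where pq: "p = cell_point j k" "q = cell_point j' k'"
      by (auto simp: cells_def)
    have "real_of_int (116 * j + 58) = of_int (116 * j' + 58)"
      using g(1) h(1) True by (simp add: pq)
    then have "j = j'" by (simp only: of_int_eq_iff)
    then have "k \<noteq> k'" using pq assms(3) by auto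
    then have "58 \<le> \<bar>(117 * k + 58) - (117 * k' + 58)\<bar>" by linarith
    then have "58 \<le> \<bar>(p - q) $ 1\<bar>" unfolding pq by simp
    also have "\<dots> \<le> dist p q" unfolding dist_norm by (rule component_le_norm_cart)
    finally show ?thesis .
  qed
qed

lemma Big_radius:
  assumes "K \<in> Big"
  shows "radius K \<ge> 29"
proof -
  obtain p q where K: "K \<in> F" and pq: "p \<in> P" "q \<in> P" "f p = K" "f q = K" "p \<noteq> q"
    "p $ 2 \<noteq> q $ 2 \<or> p \<in> cells m"
    using assms by (auto simp: Big_def fibre_def)
  have "p \<in> frontier K" "q \<in> frontier K" using f[OF pq(1)] f[OF pq(2)] pq(3,4) by auto
  then have "dist (center K) p = radius K" "dist (center K) q = radius K"
    using disk_eq(2)[OF disks[OF K]] by (metis frontier_cball mem_sphere)+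
  moreover have "dist p q \<le> dist (center K) p + dist (center K) q" by (rule dist_triangle3)
  ultimately show ?thesis using far_apart[OF pq(1,2,5,6)] by linarith
qed

lemma line_disks: "0 \<le> j \<Longrightarrow> j \<le> int m \<Longrightarrow>
  disks_on_line (\<lambda>K. center K $ 1) (\<lambda>K. center K $ 2 - of_int (116 * j)) radius F Big (117 * int m)
    (\<lambda>i. f (wall_point j i))"
proof
  fix K assume "K \<in> F" then show "radius K > 0" using disks disk_eq by blast
next
  fix i assume j: "0 \<le> j" "j \<le> int m" and i: "i \<in> {0..<117 * int m}"
  then have w: "wall_point j i \<in> walls m" by (auto simp: walls_def)
  then show "f (wall_point j i) \<in> F" using f by blast
  then show "(center (f (wall_point j i)) $ 1 - of_int i)\<^sup>2 +
       (center (f (wall_point j i)) $ 2 - of_int (116 * j))\<^sup>2 = (radius (f (wall_point j i)))\<^sup>2"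
    using disk_frontier[of "f (wall_point j i)" "wall_point j i"] f disks w by auto
  fix K assume K: "K \<in> F"
  have "wall_point j i \<notin> interior K" using empty[OF K] w by blast
  then show "(radius K)\<^sup>2 \<le> (center K $ 1 - of_int i)\<^sup>2 + (center K $ 2 - of_int (116 * j))\<^sup>2"
    using disk_interior[OF disks[OF K]] by force
next
  fix K L assume "K \<in> F" "L \<in> F" "K \<noteq> L"
  then show "(radius K + radius L)\<^sup>2 \<le> (center K $ 1 - center L $ 1)\<^sup>2 +
      (center K $ 2 - of_int (116 * j) - (center L $ 2 - of_int (116 * j)))\<^sup>2"
    using disk_disjoint[OF disks disks disj] by simp
qed (rule Big_radius)

text \<open>Every disk has total weight at most 2, whereas the average weight is 1 on the lines (up to the
  loss at their ends) but 2 on the isolated points.\<close>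

definition weight :: "real^2 \<Rightarrow> nat" where
  "weight p = (if p \<in> cells m then 2 else if f p \<in> Big then 0
    else if fibre (f p) = {p} then 2 else 1)"

text \<open>In a big disk only isolated points have weight, and there is at most one. Any other disk
  serves at most one point, or two points of one line of weight 1 each.\<close>

lemma sum_weight_fibre:
  assumes K: "K \<in> F"
  shows "sum weight (fibre K) \<le> 2"
proof (cases "K \<in> Big")
  case True
  have "sum weight (fibre K) = sum weight (fibre K \<inter> cells m)"
    using True by (intro sum.mono_neutral_right finite_fibre) (auto simp: weight_def fibre_def)
  also have "\<dots> \<le> 2"
  proof (cases "fibre K \<inter> cells m = {}")
    case False
    then obtain p where p: "p \<in> fibre K" "p \<in> cells m" by blast
    have "q = p" if q: "q \<in> fibre K" "q \<in> cells m" for q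
    proof -
      have "p \<in> frontier K" "q \<in> frontier K" using p q f[of p] f[of q] by (auto simp: fibre_def)
      then show ?thesis
        using unique_cell_point_on_empty_disk[OF disks[OF K], of m q p] empty[OF K] p q by blast
    qed
    then have "fibre K \<inter> cells m = {p}" using p by blast
    then show ?thesis using p by (simp add: weight_def)
  qed simp
  finally show ?thesis .
next
  case False
  show ?thesis
  proof (cases "\<exists>p. fibre K \<subseteq> {p}")
    case True
    then obtain p where "fibre K \<subseteq> {p}" by blast
    then have "fibre K = {} \<or> fibre K = {p}" by blast
    moreover have "weight p \<le> 2" by (simp add: weight_def)
    ultimately show ?thesis by (elim disjE) simp_all
  next
    case many: False
    then obtain p q where pq: "p \<in> fibre K" "q \<in> fibre K" "p \<noteq> q" by blast
    have no: "x \<notin> cells m \<and> x $ 2 = p $ 2" if x: "x \<in> fibre K" for x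
    proof (cases "x = p")
      case True
      then show ?thesis using False K pq by (auto simp: Big_def)
    next
      case ne: False
      then show ?thesis using False K pq x by (auto simp: Big_def)
    qed
    have "p \<in> walls m" using no[OF pq(1)] pq(1) by (auto simp: fibre_def)
    then obtain j i where p: "p = wall_point j i" and j: "0 \<le> j" "j \<le> int m"
      by (auto simp: walls_def)
    interpret disks_on_line "\<lambda>K. center K $ 1" "\<lambda>K. center K $ 2 - of_int (116 * j)" radius F Big
      "117 * int m" "\<lambda>i. f (wall_point j i)" by (rule line_disks[OF j])
    have "fibre K \<subseteq> wall_point j ` {i \<in> {0..<117 * int m}. f (wall_point j i) = K}"
    proof
      fix x assume x: "x \<in> fibre K"
      then obtain j' i' where x': "x = wall_point j' i'" "i' \<in> {0..<117 * int m}"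
        using no[OF x] by (auto simp: fibre_def walls_def)
      have "j' = j" using no[OF x] x' p by simp
      then show "x \<in> wall_point j ` {i \<in> {0..<117 * int m}. f (wall_point j i) = K}"
        using x x' by (auto simp: fibre_def)
    qed
    then have "card (fibre K) \<le> card (wall_point j ` {i \<in> {0..<117 * int m}. f (wall_point j i) = K})"
      by (rule card_mono[rotated]) (rule finite_imageI, rule finite_subset[of _ "{0..<117 * int m}"], auto)
    also have "\<dots> \<le> card {i \<in> {0..<117 * int m}. f (wall_point j i) = K}"
      by (rule card_image_le) (rule finite_subset[of _ "{0..<117 * int m}"], auto)
    also have "\<dots> \<le> 2" by (rule card_fibre)
    finally have "card (fibre K) \<le> 2" .
    moreover have "weight x = 1" if "x \<in> fibre K" for x
    proof -
      have "fibre K \<noteq> {x}" using many by blast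
      then show ?thesis using no[OF that] that False by (auto simp: weight_def fibre_def)
    qed
    ultimately show ?thesis by simp
  qed
qed

lemma sum_weight_le: "sum weight P \<le> 2 * card F"
proof -
  have "sum weight P = (\<Sum>K\<in>F. sum weight (fibre K))"
    unfolding fibre_def by (rule sum.group[symmetric]) (use f finF in auto)
  also have "\<dots> \<le> (\<Sum>K\<in>F. 2)" by (intro sum_mono sum_weight_fibre)
  finally show ?thesis by simp
qed

text \<open>Compared with weight 1, a singly covered point gains 1 and a point of a big disk loses
  1; up to 16, the gains make up for the losses.\<close>

lemma sum_weight_line:
  assumes j: "0 \<le> j" "j \<le> int m"
  shows "117 * m \<le> (\<Sum>i\<in>{0..<117 * int m}. weight (wall_point j i)) + 16"
proof -
  interpret disks_on_line "\<lambda>K. center K $ 1" "\<lambda>K. center K $ 2 - of_int (116 * j)" radius F Big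
    "117 * int m" "\<lambda>i. f (wall_point j i)" by (rule line_disks[OF j])
  let ?I = "{0..<117 * int m}"
  let ?B = "{i \<in> ?I. f (wall_point j i) \<in> Big}"
  let ?S = "{i \<in> ?I. f (wall_point j i) \<notin> Big \<and> (\<forall>i'\<in>?I. f (wall_point j i') = f (wall_point j i) \<longrightarrow> i' = i)}"
  have *: "1 + (if i \<in> ?S then 1 else 0) \<le> weight (wall_point j i) + (if i \<in> ?B then 1 else 0)"
    if i: "i \<in> ?I" for i
  proof (cases "i \<in> ?S")
    case True
    let ?p = "wall_point j i"
    have nc: "?p \<notin> cells m" using wall_point_ne_cell_point by (auto simp: cells_def)
    have pw: "?p \<in> fibre (f ?p)" using i j by (auto simp: fibre_def walls_def)
    have "x = ?p" if x: "x \<in> fibre (f ?p)" for x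
    proof (rule ccontr)
      assume "x \<noteq> ?p"
      have K: "f ?p \<in> F" "f ?p \<notin> Big" using f pw True by (auto simp: fibre_def)
      have "x $ 2 = ?p $ 2" "x \<notin> cells m"
        using K x pw \<open>x \<noteq> ?p\<close> unfolding Big_def by blast+
      then obtain j' i' where x': "x = wall_point j' i'" "i' \<in> ?I"
        using x by (auto simp: fibre_def walls_def)
      have "j' = j" using \<open>x $ 2 = ?p $ 2\<close> x' by simp
      then have "i' = i" using True x' x by (auto simp: fibre_def)
      then show False using \<open>x \<noteq> ?p\<close> x' \<open>j' = j\<close> by simp
    qed
    then have "fibre (f ?p) = {?p}" using pw by blast
    then show ?thesis using nc True by (simp add: weight_def)
  next
    case False
    then have S: "(if i \<in> ?S then 1 else 0) = (0::nat)" by (rule if_not_P)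
    show ?thesis
    proof (cases "f (wall_point j i) \<in> Big")
      case True
      then have "i \<in> ?B" using i by blast
      then show ?thesis unfolding S by simp
    next
      case False
      then have "weight (wall_point j i) \<ge> 1" by (simp add: weight_def)
      then show ?thesis unfolding S by simp
    qed
  qed
  have ind: "(\<Sum>i\<in>?I. if i \<in> A then 1 else 0) = card A" if "A \<subseteq> ?I" for A
    using that by (simp add: sum.If_cases Int_absorb1)
  have S: "?S \<subseteq> ?I" and B: "?B \<subseteq> ?I" by blast+
  have "117 * m + card ?S = (\<Sum>i\<in>?I. 1 + (if i \<in> ?S then 1 else 0))"
    unfolding sum.distrib ind[OF S] by (simp add: nat_mult_distrib)
  also have "\<dots> \<le> (\<Sum>i\<in>?I. weight (wall_point j i) + (if i \<in> ?B then 1 else 0))"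
    by (intro sum_mono *)
  also have "\<dots> = (\<Sum>i\<in>?I. weight (wall_point j i)) + card ?B"
    unfolding sum.distrib ind[OF B] ..
  finally show ?thesis using card_big_le_card_single by linarith
qed

lemma card_F_ge: "(m + 1) * (117 * m) + 2 * (m * m) \<le> 2 * card F + 16 * (m + 1)"
proof -
  have "(m + 1) * (117 * m) = (\<Sum>j\<in>{0..int m}. 117 * m)" by (simp add: nat_add_distrib)
  also have "\<dots> \<le> (\<Sum>j\<in>{0..int m}. (\<Sum>i\<in>{0..<117 * int m}. weight (wall_point j i)) + 16)"
    by (intro sum_mono sum_weight_line) auto
  also have "\<dots> = (\<Sum>j\<in>{0..int m}. (\<Sum>i\<in>{0..<117 * int m}. weight (wall_point j i))) + 16 * (m + 1)"
    by (simp add: sum.distrib nat_add_distrib)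
  also have "(\<Sum>j\<in>{0..int m}. (\<Sum>i\<in>{0..<117 * int m}. weight (wall_point j i))) = sum weight (walls m)"
    unfolding walls_def sum.reindex[OF inj_wall] sum.cartesian_product
    by (simp add: case_prod_unfold)
  finally have "(m + 1) * (117 * m) \<le> sum weight (walls m) + 16 * (m + 1)" .
  moreover have "sum weight (cells m) = 2 * (m * m)"
    by (simp add: weight_def card_cells)
  moreover have "sum weight P = sum weight (walls m) + sum weight (cells m)"
    by (rule sum.union_disjoint) (use walls_cells_disjoint in auto)
  ultimately show ?thesis using sum_weight_le by linarith
qed

end

lemma min_disks_grid:
  "(m + 1) * (117 * m) + 2 * (m * m) \<le> 2 * min_disks (walls m \<union> cells m) + 16 * (m + 1)"
proof -
  obtain F where F: "disk_cover (walls m \<union> cells m) F" "card F = min_disks (walls m \<union> cells m)"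
    using min_disks_attained[of "walls m \<union> cells m"] by auto
  have "\<forall>p\<in>walls m \<union> cells m. \<exists>K. K \<in> F \<and> p \<in> frontier K"
    using F(1) by (auto simp: disk_cover_def)
  then obtain f where "\<forall>p\<in>walls m \<union> cells m. f p \<in> F \<and> p \<in> frontier (f p)" by metis
  then interpret grid_cover m F f using F by unfold_locales auto
  show ?thesis using card_F_ge F(2) by simp
qed

section \<open>From grids to arbitrary n\<close>

lemma min_disks_mono:
  assumes "finite Q" "P \<subseteq> Q"
  shows "min_disks P \<le> min_disks Q"
proof -
  obtain F where F: "disk_cover Q F" "card F = min_disks Q" using min_disks_attained assms by blast
  then have "disk_cover P F" using assms by (auto simp: disk_cover_def empty_disk_def)
  then show ?thesis using min_disks_le F by metis
qed

lemma max_min_disks_ge: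
  assumes "finite P" "card P \<le> n"
  shows "min_disks P \<le> max_min_disks n"
proof -
  have "infinite (- P)"
    using assms(1) finite_Un[of P "- P"] not_bounded_UNIV finite_imp_bounded by (metis Compl_partition)
  then obtain A where A: "finite A" "card A = n - card P" "A \<subseteq> - P"
    using infinite_arbitrarily_large by blast
  have "card (P \<union> A) = n" using A assms by (subst card_Un_disjoint) auto
  then have "min_disks (P \<union> A) \<le> max_min_disks n"
    unfolding max_min_disks_def using A assms by (intro Max_ge finite_min_disks) auto
  then show ?thesis using min_disks_mono[of "P \<union> A" P] A assms by auto
qed

theorem theorem2:
  shows "\<exists>C::real. C > 0 \<and>
    (\<forall>n::nat. n \<ge> 1 \<longrightarrow>
      real (max_min_disks n) \<ge> real n / 2 + real n / 236 - C * sqrt (real n))"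
proof (intro exI[of _ 1000] conjI allI impI)
  fix n :: nat assume "n \<ge> 1"
  define s where "s = sqrt (real n)"
  have s: "s * s = real n" "s \<ge> 1" using \<open>n \<ge> 1\<close> by (auto simp: s_def)
  \<comment> \<open>The grid with parameter \<open>k - 1\<close> has at most 118 * k^2 points, hence
    at most \<open>n\<close>.\<close>
  define k where "k = nat \<lfloor>sqrt (real n / 118)\<rfloor>"
  have k: "real k \<le> sqrt (real n / 118)" "sqrt (real n / 118) < real k + 1"
    unfolding k_def by (simp_all add: of_nat_nat)
  have k1: "118 * (real k * real k) \<le> real n"
    using power_mono[OF k(1), of 2] by (simp add: power2_eq_square)
  have "(sqrt (real n / 118))\<^sup>2 < (real k + 1)\<^sup>2" using k by (intro power_strict_mono) auto
  then have k2: "real n < 118 * ((real k + 1) * (real k + 1))" by (simp add: power2_eq_square)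
  have "real k * real k \<le> s * s" using k1 s by simp
  then have ks: "real k \<le> s"
    using s by (metis abs_le_square_iff abs_of_nat abs_of_nonneg order_trans power2_eq_square zero_le_one)
  have "real n / 2 + real n / 236 \<le> real (max_min_disks n) + 1000 * s"
  proof (cases k)
    \<comment> \<open>Fewer than 118 points: the error term alone suffices.\<close>
    case 0
    then have "s * s < 118" using k2 s by simp
    then have "s < 11" using s mult_mono[of 11 s 11 s] by linarith
    then have "real n \<le> 11 * s" using s mult_right_mono[of s 11 s] by linarith
    then show ?thesis using s by simp
  next
    case (Suc m)
    let ?P = "walls m \<union> cells m"
    have "card ?P = (m + 1) * (117 * m) + m * m"
      using walls_cells_disjoint by (subst card_Un_disjoint) (auto simp: card_walls card_cells)
    also have "\<dots> \<le> 118 * (k * k)" by (simp add: Suc algebra_simps)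
    also have "\<dots> \<le> n" using k1 by (simp flip: of_nat_mult add: of_nat_le_iff)
    finally have "min_disks ?P \<le> max_min_disks n" by (intro max_min_disks_ge) auto
    then have "(m + 1) * (117 * m) + 2 * (m * m) \<le> 2 * max_min_disks n + 16 * (m + 1)"
      using min_disks_grid[of m] by linarith
    then have "real ((m + 1) * (117 * m) + 2 * (m * m)) \<le> real (2 * max_min_disks n + 16 * (m + 1))"
      by (simp only: of_nat_le_iff)
    then have "119 * (real m * real m) + 101 * real m - 16 \<le> 2 * real (max_min_disks n)"
      by (simp add: algebra_simps)
    moreover have "real n \<le> 118 * (real m * real m) + 472 * real m + 472"
      using k2 Suc by (simp add: algebra_simps)
    moreover have "real m \<le> s" using ks Suc by simp
    \<comment> \<open>Both sides have leading term 119/2 * m^2; they differ by at most 188 * m +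
      246, well below 1000 * s.\<close>
    ultimately show ?thesis using s(2) by linarith
  qed
  then show "real (max_min_disks n) \<ge> real n / 2 + real n / 236 - 1000 * sqrt (real n)"
    by (simp add: s_def)
qed simp

end
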